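(* Let $(f,x_0)$ be an $(\mathcal F_{0,L},R_x)$-input for some real $L>0$ and $R_x\ge0$. 1. For any $N\in\mathbb N$, $$f(\mathrm{GFOM}_N(f,x_0))-f_*\le\frac{LR_x^2}{2\theta_{N,N}^2}.$$ Furthermore, this bound is tight when $d\ge2N+2$. 2. For any $N\in\mathbb N$ and any sequence $x_1,\dots,x_N$ that satisfies $$\Big\langle f'(x_i),\ x_i-\Big[\Big(1-\frac1{\theta_{i,N}}\Big)\Big(x_{i-1}-\frac1Lf'(x_{i-1})\Big)+\frac1{\theta_{i,N}}\Big(x_0-\frac2L\sum_{j=0}^{i-1}\theta_{j,N}f'(x_j)\Big)\Big]\Big\rangle=0,\qquad i=1,\dots,N,$$ we have $$f(x_N)-f_*\le\frac{LR_x^2}{2\theta_{N,N}^2}.$$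
   Context: $\langle\cdot,\cdot\rangle$, $\|\cdot\|$ are the Euclidean inner product and norm on $\mathbb R^d$; $\mathbb N$ denotes the positive integers; $f_*:=\min f$; $f'(x)$ is the gradient of $f$ at $x$. $\mathcal F_{0,L}=\mathcal F_{0,L}(\mathbb R^d)$ is the class of convex functions on $\mathbb R^d$ that are $L$-smooth (differentiable with $L$-Lipschitz gradient). $(f,x_0)$ is an $(\mathcal F_{0,L},R_x)$-input if $f\in\mathcal F_{0,L}(\mathbb R^d)$, $x_0\in\mathbb R^d$ and $\|x_0-x_*\|\le R_x$ for some $x_*\in\operatorname{argmin}f$. For $N\ge1$: $\theta_{0,N}:=1$, $\theta_{i+1,N}:=\frac{1+\sqrt{4\theta_{i,N}^2+1}}2$ for $0\le i\le N-2$, and $\theta_{N,N}:=\frac{1+\sqrt{8\theta_{N-1,N}^2+1}}2$. GFOM (greedy first-order method): a run on $(f,x_0)$ with $N$ iterations consists of points $x_1,\dots,x_N$ such that for $i=1,\dots,N$: $x_i\in\operatorname{argmin}\{f(x): x\in x_0+\mathrm{span}\{f'(x_0),\dots,f'(x_{i-1})\}\}$ and $\langle f'(x_i),f'(x_j)\rangle=0$ for all $0\le j<i$ (automatic for differentiable $f$). Its output is $\mathrm{GFOM}_N(f,x_0):=x_N$; if the minimum over one of the subspaces is not attained, there is no output. The bound is claimed for every output. "The bound is tight" means: for every $\varepsilon>0$ there is an $(\mathcal F_{0,L}(\mathbb R^d),R_x)$-input $(\hat f,\hat x_0)$ and an output of GFOM on it such that $\hat f(\mathrm{GFOM}_N(\hat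 f,\hat x_0))-\hat f_*\ge\frac{LR_x^2}{2\theta_{N,N}^2}-\varepsilon$. *)

theory Defs
  imports "HOL-Analysis.Analysis"
begin

definition gradient :: "('a::real_inner \<Rightarrow> real) \<Rightarrow> 'a \<Rightarrow> 'a" where
  "gradient f x = (THE g. GDERIV f x :> g)"

lemma gradient_eqI: "gradient f x = g" if "GDERIV f x :> g"
proof -
  have "g' = g" if "GDERIV f x :> g'" for g'
  proof -
    have "(\<lambda>h. inner h g') = (\<lambda>h. inner h g)"
      using \<open>GDERIV f x :> g\<close> that unfolding gderiv_def by (rule has_derivative_unique[rotated])
    then show "g' = g"
      by (metis vector_eq_ldot)
  qed
  then show ?thesis
    unfolding gradient_def using that by blast
qed

text \<open>The class of convex \<open>L\<close>-smooth functions on the whole space.\<close>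

definition convex_smooth :: "real \<Rightarrow> ('a::real_inner \<Rightarrow> real) \<Rightarrow> bool" where
  "convex_smooth L f \<longleftrightarrow>
     convex_on UNIV f \<and> (\<forall>x. f differentiable (at x)) \<and> L-lipschitz_on UNIV (gradient f)"

text \<open>Meaningful only if \<open>f\<close> attains its minimum.\<close>

definition min_value :: "('a \<Rightarrow> real) \<Rightarrow> real" where
  "min_value f = f (arg_min f (\<lambda>_. True))"

lemma min_value_eqI: "min_value f = f x" if "is_arg_min f (\<lambda>_. True) x"
proof -
  have "is_arg_min f (\<lambda>_. True) (arg_min f (\<lambda>_. True))"
    unfolding arg_min_def using that by (rule someI)
  with that show ?thesis
    unfolding min_value_def by (auto simp: is_arg_min_linorder intro: antisym)
qed

definition is_input :: "real \<Rightarrow> real \<Rightarrow> ('a::real_inner \<Rightarrow> real) \<Rightarrow> 'a \<Rightarrow> bool" where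
  "is_input L R f x0 \<longleftrightarrow>
     convex_smooth L f \<and> (\<exists>xs. is_arg_min f (\<lambda>_. True) xs \<and> norm (x0 - xs) \<le> R)"

text \<open>\<open>theta i N\<close> is used only for \<open>i \<le> N\<close> and \<open>N \<ge> 1\<close>.\<close>

primrec theta :: "nat \<Rightarrow> nat \<Rightarrow> real" where
  "theta 0 N = 1"
| "theta (Suc i) N =
     (if Suc i = N then (1 + sqrt (8 * (theta i N)\<^sup>2 + 1)) / 2
      else (1 + sqrt (4 * (theta i N)\<^sup>2 + 1)) / 2)"

definition gfom_run :: "nat \<Rightarrow> ('a::real_inner \<Rightarrow> real) \<Rightarrow> 'a \<Rightarrow> (nat \<Rightarrow> 'a) \<Rightarrow> bool" where
  "gfom_run N f x0 x \<longleftrightarrow>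
     x 0 = x0 \<and>
     (\<forall>i\<in>{1..N}.
        is_arg_min f (\<lambda>y. y \<in> (+) x0 ` span ((\<lambda>j. gradient f (x j)) ` {0..<i})) (x i) \<and>
        (\<forall>j<i. inner (gradient f (x i)) (gradient f (x j)) = 0))"

text \<open>
  The greedy method is relational: minimizers over the subspaces need neither exist nor
  be unique, so an input may have no output or several.
\<close>

definition gfom_output :: "nat \<Rightarrow> ('a::real_inner \<Rightarrow> real) \<Rightarrow> 'a \<Rightarrow> 'a \<Rightarrow> bool" where
  "gfom_output N f x0 y \<longleftrightarrow> (\<exists>x. gfom_run N f x0 x \<and> y = x N)"

end

theory Submission
  imports Defs
begin

text \<open>
  \<^emph>\<open>Upper bound.\<close> Let \<open>xs\<close> be a minimizer and let \<open>w i\<close> be \<open>1\<close> for the last iterate and \<open>2\<close> for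
  the others. Put \<open>tau i = w i * theta i\<close> and let \<open>z k\<close> be \<open>x 0\<close> minus the sum over \<open>j < k\<close> of
  \<open>(tau j / L) *\<^sub>R gradient f (x j)\<close>. The potential
  \<open>w i * (theta i)\<^sup>2 * (f (x i) - f xs - (w i - 1) * (norm (gradient f (x i)))\<^sup>2 / (2 * L))
  + L / 2 * (norm (z (i + 1) - xs))\<^sup>2\<close> does not increase with \<open>i\<close> and is at first at most
  \<open>L / 2 * (norm (x 0 - xs))\<^sup>2\<close>. One step (lemma \<open>potential_step\<close>) needs just two instances of the
  cocoercivity inequality \<open>f y + inner (gradient f y) (x - y)
  + (norm (gradient f x - gradient f y))\<^sup>2 / (2 * L) \<le> f x\<close>. They give inner products with
  the gradient at \<open>x i\<close> only, so the new iterate enters through a single scalar equation, which is the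
  assumed relation. The greedy method satisfies this equation because its gradients are
  orthogonal (lemma \<open>gfom_run_orthogonality\<close>).

  \<^emph>\<open>Tightness.\<close> The bound is attained if every inequality used above is an equality. With
  orthogonal gradients \<open>L *\<^sub>R h i\<close>, a minimizer at \<open>0\<close> and \<open>z (N + 1) = 0\<close>, this forces \<open>x 0\<close> to be the
  sum of all \<open>tau j *\<^sub>R h j\<close>, and \<open>tau (i + 1) * (norm (h (i + 1)))\<^sup>2 = (tau i - 1) * (norm (h i))\<^sup>2\<close>.
  Let \<open>C\<close> be the convex hull of \<open>0\<close> and of all \<open>h i\<close>, and let \<open>F x\<close> be \<open>L\<close> times the maximum of
  \<open>inner x p - (norm p)\<^sup>2 / 2\<close> over \<open>p \<in> C\<close>. This function is convex, and its gradient is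
  \<open>L *\<^sub>R closest_point C x\<close>, which is \<open>L\<close>-Lipschitz because projections are nonexpansive. With \<open>x i\<close>
  the sum of \<open>tau j *\<^sub>R h j\<close> over \<open>j \<ge> i\<close>, the recursion for the norms makes \<open>h i\<close>
  the projection of \<open>x i\<close> onto \<open>C\<close> (lemma \<open>closest_point_x\<close>). Each greedy step hence removes one
  summand and reveals one new direction. Lemma \<open>sum_squared_norm_ratio\<close> compares the remaining
  value \<open>F (x N)\<close>, a multiple of \<open>(norm (h N))\<^sup>2\<close>, with the initial distance to the minimizer.
\<close>

section \<open>Convex functions with Lipschitz gradient\<close>

lemma GDERIV_gradient:
  fixes f :: "'a::euclidean_space \<Rightarrow> real"
  assumes "f differentiable (at x)"
  shows "GDERIV f x :> gradient f x"
proof -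
  obtain D where D: "(f has_derivative D) (at x)"
    using assms by (auto simp: differentiable_def)
  then have "linear D"
    by (rule has_derivative_linear)
  then have "D h = inner h (adjoint D 1)" for h
    using adjoint_works[of D h 1] by simp
  then have "GDERIV f x :> adjoint D 1"
    using D unfolding gderiv_def by (metis ext)
  then show ?thesis
    using gradient_eqI by metis
qed

lemma DERIV_along_line:
  fixes f :: "'a::real_inner \<Rightarrow> real"
  assumes "GDERIV f (x + t *\<^sub>R d) :> g"
  shows "((\<lambda>s. f (x + s *\<^sub>R d)) has_real_derivative inner d g) (at t)"
proof -
  have 1: "((\<lambda>s. x + s *\<^sub>R d) has_derivative (\<lambda>s. s *\<^sub>R d)) (at t)"
    by (auto intro!: derivative_eq_intros)
  have 2: "(f has_derivative (\<lambda>h. inner h g)) (at (x + t *\<^sub>R d))"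
    using assms by (simp add: gderiv_def)
  have "((\<lambda>s. f (x + s *\<^sub>R d)) has_derivative (\<lambda>s. inner (s *\<^sub>R d) g)) (at t)"
    using has_derivative_compose[OF 1 2] .
  then show ?thesis
    by (simp add: has_field_derivative_def mult.commute[of _ "inner d g"])
qed

lemma convex_on_along_line:
  assumes "convex_on UNIV f"
  shows "convex_on UNIV (\<lambda>s::real. f (x + s *\<^sub>R d))"
proof (rule convex_onI)
  fix t a b :: real
  assume "0 < t" "t < 1"
  moreover have "x + ((1 - t) *\<^sub>R a + t *\<^sub>R b) *\<^sub>R d
      = (1 - t) *\<^sub>R (x + a *\<^sub>R d) + t *\<^sub>R (x + b *\<^sub>R d)"
    by (simp add: algebra_simps)
  ultimately show "f (x + ((1 - t) *\<^sub>R a + t *\<^sub>R b) *\<^sub>R d)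
      \<le> (1 - t) * f (x + a *\<^sub>R d) + t * f (x + b *\<^sub>R d)"
    using convex_onD[OF assms, of t] by simp
qed simp

lemma convex_smooth_GDERIV:
  fixes f :: "'a::euclidean_space \<Rightarrow> real"
  assumes "convex_smooth L f"
  shows "GDERIV f x :> gradient f x"
  using assms by (simp add: convex_smooth_def GDERIV_gradient)

lemma convex_smooth_above_tangent:
  fixes f :: "'a::euclidean_space \<Rightarrow> real"
  assumes "convex_smooth L f"
  shows "f x + inner (y - x) (gradient f x) \<le> f y"
proof -
  have cvx: "convex_on UNIV (\<lambda>s::real. f (x + s *\<^sub>R (y - x)))"
    using assms by (intro convex_on_along_line) (simp add: convex_smooth_def)
  have "((\<lambda>s. f (x + s *\<^sub>R (y - x))) has_real_derivative inner (y - x) (gradient f x)) (at 0)"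
    by (rule DERIV_along_line) (simp add: convex_smooth_GDERIV[OF assms])
  from convex_on_imp_above_tangent[OF cvx _ _ _ this, of 1] show ?thesis
    by simp
qed

lemma convex_smooth_descent:
  fixes f :: "'a::euclidean_space \<Rightarrow> real"
  assumes "convex_smooth L f"
  shows "f y \<le> f x + inner (y - x) (gradient f x) + L / 2 * (norm (y - x))\<^sup>2"
proof -
  define d where "d = y - x"
  define \<phi> where "\<phi> = (\<lambda>s. f (x + s *\<^sub>R d) - s * inner d (gradient f x) - L / 2 * s\<^sup>2 * (norm d)\<^sup>2)"
  have "\<phi> 1 \<le> \<phi> 0"
  proof (rule DERIV_nonpos_imp_nonincreasing[of 0 1 \<phi>])
    fix t :: real
    assume t: "0 \<le> t" "t \<le> 1"
    let ?D = "inner d (gradient f (x + t *\<^sub>R d)) - inner d (gradient f x) - L * t * (norm d)\<^sup>2"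
    have "(\<phi> has_real_derivative ?D) (at t)"
      unfolding \<phi>_def
      by (auto intro!: derivative_eq_intros DERIV_along_line convex_smooth_GDERIV[OF assms])
    moreover have "?D \<le> 0"
    proof -
      have "inner d (gradient f (x + t *\<^sub>R d) - gradient f x)
          \<le> norm d * norm (gradient f (x + t *\<^sub>R d) - gradient f x)"
        by (rule norm_cauchy_schwarz)
      also have "\<dots> \<le> norm d * (L * (t * norm d))"
        using assms t lipschitz_onD[of L UNIV "gradient f" "x + t *\<^sub>R d" x]
        by (intro mult_left_mono) (auto simp: convex_smooth_def dist_norm)
      finally show ?thesis
        by (simp add: inner_diff_right power2_eq_square mult_ac)
    qed
    ultimately show "\<exists>D. (\<phi> has_real_derivative D) (at t) \<and> D \<le> 0"
      by blast
  qed simp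
  then show ?thesis
    by (simp add: \<phi>_def d_def)
qed

text \<open>
  The tangent at \<open>y\<close> is compared with the quadratic upper model at \<open>x\<close> in the minimizer of
  their difference, which is a gradient step from \<open>x\<close> on \<open>f\<close> minus that tangent.
\<close>

lemma convex_smooth_cocoercive:
  fixes f :: "'a::euclidean_space \<Rightarrow> real"
  assumes "convex_smooth L f" and "L > 0"
  shows "f y + inner (gradient f y) (x - y) + (norm (gradient f x - gradient f y))\<^sup>2 / (2 * L) \<le> f x"
proof -
  define u where "u = gradient f x - gradient f y"
  define z where "z = x - (1 / L) *\<^sub>R u"
  have "f y + inner (z - y) (gradient f y) \<le> f x + inner (z - x) (gradient f x) + L / 2 * (norm (z - x))\<^sup>2"
    using convex_smooth_above_tangent[OF assms(1), of y z] convex_smooth_descent[OF assms(1), of z x]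
    by linarith
  moreover have "L / 2 * (norm (z - x))\<^sup>2 = (norm u)\<^sup>2 / (2 * L)"
    using \<open>L > 0\<close> by (simp add: z_def power_divide power2_eq_square)
  moreover have "inner (z - y) (gradient f y) - inner (z - x) (gradient f x)
      = inner (gradient f y) (x - y) + (norm u)\<^sup>2 / L"
    unfolding z_def u_def power2_norm_eq_inner
    by (simp add: inner_simps inner_commute diff_divide_distrib add_divide_distrib)
  ultimately show ?thesis
    unfolding u_def[symmetric] by (simp add: field_simps)
qed

lemma gradient_minimizer:
  fixes f :: "'a::euclidean_space \<Rightarrow> real"
  assumes "convex_smooth L f" and "L > 0" and "is_arg_min f (\<lambda>_. True) x"
  shows "gradient f x = 0"
proof -
  define u where "u = gradient f x"
  let ?z = "x - (1 / L) *\<^sub>R u"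
  have "f x \<le> f ?z"
    using assms(3) by (simp add: is_arg_min_linorder)
  also have "f ?z \<le> f x + inner (?z - x) u + L / 2 * (norm (?z - x))\<^sup>2"
    unfolding u_def by (rule convex_smooth_descent[OF assms(1)])
  also have "\<dots> = f x - (norm u)\<^sup>2 / (2 * L)"
    using \<open>L > 0\<close> by (simp add: power_divide field_simps power2_eq_square flip: power2_norm_eq_inner)
  finally show ?thesis
    using \<open>L > 0\<close> by (simp add: u_def field_simps)
qed

section \<open>The parameters\<close>

text \<open>
  The last iterate is treated differently from the others. All formulas become uniform in \<open>i\<close>
  once this difference is put into a factor.
\<close>

definition last_factor :: "nat \<Rightarrow> nat \<Rightarrow> real" where
  "last_factor i N = (if i < N then 2 else 1)"

definition tau :: "nat \<Rightarrow> nat \<Rightarrow> real" where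
  "tau i N = last_factor i N * theta i N"

lemma theta_ge_1: "1 \<le> theta i N"
  by (cases i) auto

lemma tau_ge_1: "1 \<le> tau i N"
  using theta_ge_1[of i N] by (simp add: tau_def last_factor_def)

lemma theta_recurrence:
  assumes "i < N"
  shows "last_factor (Suc i) N * ((theta (Suc i) N)\<^sup>2 - theta (Suc i) N) = 2 * (theta i N)\<^sup>2"
proof -
  have root: "((1 + sqrt (4 * c + 1)) / 2)\<^sup>2 - (1 + sqrt (4 * c + 1)) / 2 = c" if "c \<ge> 0" for c :: real
  proof -
    have "(sqrt (4 * c + 1))\<^sup>2 = 4 * c + 1"
      using that by simp
    then show ?thesis
      by (simp add: power2_eq_square field_simps)
  qed
  show ?thesis
    using assms root[of "(theta i N)\<^sup>2"] root[of "2 * (theta i N)\<^sup>2"]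
    by (auto simp: last_factor_def)
qed

section \<open>The upper bound\<close>

text \<open>
  The potential decrease is the sum of the inequality between \<open>x'\<close> and the minimizer \<open>xs\<close>,
  weighted by \<open>w * t\<close>, and of the inequality between \<open>x'\<close> and the previous iterate \<open>x\<close>, weighted
  by \<open>w * (t\<^sup>2 - t)\<close>. All that is left over is a multiple of the inner product in the
  assumption \<open>orth\<close>.
\<close>

lemma potential_step:
  fixes x x' xs z g g' :: "'a::real_inner"
  assumes "L > 0" and "w \<ge> 0" and "t \<ge> 1"
    and star: "F' + inner g' (xs - x') + (norm g')\<^sup>2 / (2 * L) \<le> fs"
    and prev: "F' + inner g' (x - x') + (norm (g - g'))\<^sup>2 / (2 * L) \<le> F"
    and orth: "inner g' (t *\<^sub>R x' - ((t - 1) *\<^sub>R (x - (1 / L) *\<^sub>R g) + z)) = 0"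
  shows "w * t\<^sup>2 * (F' - fs - (w - 1) * (norm g')\<^sup>2 / (2 * L))
        + L / 2 * (norm (z - (w * t / L) *\<^sub>R g' - xs))\<^sup>2
      \<le> w * (t\<^sup>2 - t) * (F - fs - (norm g)\<^sup>2 / (2 * L)) + L / 2 * (norm (z - xs))\<^sup>2"
proof -
  define u where "u = 1 / L"
  define G H K a b c e where scalars:
    "G = inner g' g'" "H = inner g' g" "K = inner g g" "a = inner g' x'" "b = inner g' x"
    "c = inner g' xs" "e = inner g' z"
  have div_L: "r / L = r * u" "r / (2 * L) = r * u / 2" for r
    by (simp_all add: u_def)
  have A: "0 \<le> w * t * (fs - (F' + (c - a) + G * u / 2))"
    using star assms by (simp add: scalars div_L inner_simps power2_norm_eq_inner)
  have B: "0 \<le> w * (t\<^sup>2 - t) * (F - (F' + (b - a) + (K + G - 2 * H) * u / 2))"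
  proof -
    have "0 \<le> t\<^sup>2 - t"
      using \<open>t \<ge> 1\<close> by (simp add: power2_eq_square)
    moreover have "0 \<le> F - (F' + (b - a) + (K + G - 2 * H) * u / 2)"
      using prev by (simp add: scalars div_L inner_simps power2_norm_eq_inner inner_commute[of g g'])
    ultimately show ?thesis
      using \<open>w \<ge> 0\<close> by simp
  qed
  have e: "e = t * a - (t - 1) * (b - H * u)"
    using orth by (simp add: scalars div_L inner_simps)
  have sq: "L / 2 * (norm (z - (w * t / L) *\<^sub>R g' - xs))\<^sup>2
      = L / 2 * (norm (z - xs))\<^sup>2 - w * t * (e - c) + w\<^sup>2 * t\<^sup>2 * G * u / 2"
  proof -
    have "(norm (z - (w * t / L) *\<^sub>R g' - xs))\<^sup>2
        = (norm (z - xs))\<^sup>2 - 2 * (w * t * u) * (e - c) + (w * t * u)\<^sup>2 * G"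
      unfolding power2_norm_eq_inner scalars div_L
      by (simp add: inner_simps inner_commute power2_eq_square algebra_simps)
    then show ?thesis
      using \<open>L > 0\<close> by (simp add: u_def field_simps power2_eq_square)
  qed
  show ?thesis
    using A B
    unfolding sq e
    unfolding power2_norm_eq_inner[of g] power2_norm_eq_inner[of g'] scalars(1,3)[symmetric] div_L
    by (simp add: power2_eq_square algebra_simps add_divide_distrib diff_divide_distrib)
qed

text \<open>
  The hypothesis on the inner products is the relation that defines the method, multiplied by
  \<open>theta k N\<close>: in this form it enters the potential step.
\<close>

lemma potential_bound:
  fixes f :: "'a::euclidean_space \<Rightarrow> real" and x :: "nat \<Rightarrow> 'a"
  assumes "convex_smooth L f" and "L > 0" and "is_arg_min f (\<lambda>_. True) xs"
    and orth: "\<And>k. 1 \<le> k \<Longrightarrow> k \<le> N \<Longrightarrow>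
      inner (gradient f (x k))
        (theta k N *\<^sub>R x k
          - ((theta k N - 1) *\<^sub>R (x (k - 1) - (1 / L) *\<^sub>R gradient f (x (k - 1)))
             + (x 0 - (1 / L) *\<^sub>R (\<Sum>j<k. tau j N *\<^sub>R gradient f (x j))))) = 0"
    and "i \<le> N"
  shows "last_factor i N * (theta i N)\<^sup>2
        * (f (x i) - f xs - (last_factor i N - 1) * (norm (gradient f (x i)))\<^sup>2 / (2 * L))
        + L / 2 * (norm (x 0 - (1 / L) *\<^sub>R (\<Sum>j<Suc i. tau j N *\<^sub>R gradient f (x j)) - xs))\<^sup>2
      \<le> L / 2 * (norm (x 0 - xs))\<^sup>2"
proof -
  define g where "g = (\<lambda>k. gradient f (x k))"
  define z where "z = (\<lambda>k. x 0 - (1 / L) *\<^sub>R (\<Sum>j<k. tau j N *\<^sub>R g j))"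
  have z_Suc: "z (Suc k) = z k - (last_factor k N * theta k N / L) *\<^sub>R g k" for k
    by (simp add: z_def tau_def scaleR_right_distrib)
  have lf_nonneg: "0 \<le> last_factor k N" for k
    by (simp add: last_factor_def)
  have star: "f (x k) + inner (g k) (xs - x k) + (norm (g k))\<^sup>2 / (2 * L) \<le> f xs" for k
    using convex_smooth_cocoercive[OF assms(1,2), of "x k" xs] gradient_minimizer[OF assms(1-3)]
    by (simp add: g_def)
  have prev: "f (x k) + inner (g k) (x j - x k) + (norm (g j - g k))\<^sup>2 / (2 * L) \<le> f (x j)" for j k
    using convex_smooth_cocoercive[OF assms(1,2), of "x k" "x j"] by (simp add: g_def)
  have "last_factor i N * (theta i N)\<^sup>2 * (f (x i) - f xs - (last_factor i N - 1) * (norm (g i))\<^sup>2 / (2 * L))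
        + L / 2 * (norm (z (Suc i) - xs))\<^sup>2 \<le> L / 2 * (norm (z 0 - xs))\<^sup>2"
    using \<open>i \<le> N\<close>
  proof (induction i)
    case 0
    \<comment> \<open>As \<open>theta 0 N = 1\<close>, the previous iterate has weight zero and may be \<open>x 0\<close> itself.\<close>
    have "last_factor 0 N * (theta 0 N)\<^sup>2
          * (f (x 0) - f xs - (last_factor 0 N - 1) * (norm (g 0))\<^sup>2 / (2 * L))
          + L / 2 * (norm (z (Suc 0) - xs))\<^sup>2
        \<le> last_factor 0 N * ((theta 0 N)\<^sup>2 - theta 0 N)
          * (f (x 0) - f xs - (norm (g 0))\<^sup>2 / (2 * L)) + L / 2 * (norm (z 0 - xs))\<^sup>2"
      unfolding z_Suc[of 0]
      by (intro potential_step[OF \<open>L > 0\<close> lf_nonneg theta_ge_1 star prev]) (simp add: z_def)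
    then show ?case
      by simp
  next
    case (Suc i)
    have "last_factor (Suc i) N * (theta (Suc i) N)\<^sup>2
          * (f (x (Suc i)) - f xs - (last_factor (Suc i) N - 1) * (norm (g (Suc i)))\<^sup>2 / (2 * L))
          + L / 2 * (norm (z (Suc (Suc i)) - xs))\<^sup>2
        \<le> last_factor (Suc i) N * ((theta (Suc i) N)\<^sup>2 - theta (Suc i) N)
          * (f (x i) - f xs - (norm (g i))\<^sup>2 / (2 * L)) + L / 2 * (norm (z (Suc i) - xs))\<^sup>2"
      unfolding z_Suc[of "Suc i"]
      using orth[of "Suc i"] Suc.prems
      by (intro potential_step[OF \<open>L > 0\<close> lf_nonneg theta_ge_1 star prev]) (simp add: z_def g_def)
    also have "\<dots> \<le> L / 2 * (norm (z 0 - xs))\<^sup>2"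
      using Suc theta_recurrence[of i N] by (simp add: last_factor_def)
    finally show ?case .
  qed
  then show ?thesis
    by (simp only: z_def g_def) simp
qed

theorem convergence_rate:
  fixes f :: "'a::euclidean_space \<Rightarrow> real" and x :: "nat \<Rightarrow> 'a"
  assumes "L > 0" and "is_input L R f (x 0)"
    and orth: "\<And>i. i \<in> {1..N} \<Longrightarrow>
      inner (gradient f (x i))
        (x i - ((1 - 1 / theta i N) *\<^sub>R (x (i - 1) - (1 / L) *\<^sub>R gradient f (x (i - 1)))
              + (1 / theta i N) *\<^sub>R
                  (x 0 - (2 / L) *\<^sub>R (\<Sum>j=0..i-1. theta j N *\<^sub>R gradient f (x j))))) = 0"
  shows "f (x N) - min_value f \<le> L * R\<^sup>2 / (2 * (theta N N)\<^sup>2)"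
proof -
  obtain xs where cs: "convex_smooth L f"
    and xs: "is_arg_min f (\<lambda>_. True) xs" "norm (x 0 - xs) \<le> R"
    using assms(2) by (auto simp: is_input_def)
  have rescale: "t *\<^sub>R p - ((t - 1) *\<^sub>R q + r)
      = t *\<^sub>R (p - ((1 - 1 / t) *\<^sub>R q + (1 / t) *\<^sub>R r))" if "1 \<le> t" for t and p q r :: 'a
  proof -
    have "t * (1 - 1 / t) = t - 1" "t * (1 / t) = 1"
      using that by (simp_all add: right_diff_distrib)
    then show ?thesis
      unfolding scaleR_diff_right scaleR_add_right scaleR_scaleR by simp
  qed
  have scaled: "inner (gradient f (x k))
        (theta k N *\<^sub>R x k
          - ((theta k N - 1) *\<^sub>R (x (k - 1) - (1 / L) *\<^sub>R gradient f (x (k - 1)))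
             + (x 0 - (1 / L) *\<^sub>R (\<Sum>j<k. tau j N *\<^sub>R gradient f (x j))))) = 0"
    (is "inner ?g ?v = 0") if k: "1 \<le> k" "k \<le> N" for k
  proof -
    have "{0..k-1} = {..<k}"
      using k by auto
    then have "(\<Sum>j<k. tau j N *\<^sub>R gradient f (x j))
        = 2 *\<^sub>R (\<Sum>j=0..k-1. theta j N *\<^sub>R gradient f (x j))"
      using k by (simp add: scaleR_sum_right tau_def last_factor_def)
    then have v: "(1 / L) *\<^sub>R (\<Sum>j<k. tau j N *\<^sub>R gradient f (x j))
        = (2 / L) *\<^sub>R (\<Sum>j=0..k-1. theta j N *\<^sub>R gradient f (x j))"
      by simp
    have "?v = theta k N *\<^sub>R
        (x k - ((1 - 1 / theta k N) *\<^sub>R (x (k - 1) - (1 / L) *\<^sub>R gradient f (x (k - 1)))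
              + (1 / theta k N) *\<^sub>R
                  (x 0 - (2 / L) *\<^sub>R (\<Sum>j=0..k-1. theta j N *\<^sub>R gradient f (x j)))))"
      (is "_ = _ *\<^sub>R ?u")
      unfolding v by (rule rescale[OF theta_ge_1])
    moreover have "inner ?g ?u = 0"
      using orth[of k] k by simp
    ultimately show ?thesis
      by (simp only: inner_scaleR_right mult_zero_right)
  qed
  have "(theta N N)\<^sup>2 * (f (x N) - f xs) \<le> L / 2 * (norm (x 0 - xs))\<^sup>2
      - L / 2 * (norm (x 0 - (1 / L) *\<^sub>R (\<Sum>j<Suc N. tau j N *\<^sub>R gradient f (x j)) - xs))\<^sup>2"
    using potential_bound[OF cs \<open>L > 0\<close> xs(1) scaled order.refl] by (simp add: last_factor_def)
  also have "\<dots> \<le> L / 2 * (norm (x 0 - xs))\<^sup>2"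
    using \<open>L > 0\<close> by simp
  also have "\<dots> \<le> L / 2 * R\<^sup>2"
    using \<open>L > 0\<close> xs(2) by (intro mult_left_mono power_mono) auto
  finally show ?thesis
    using theta_ge_1[of N N] by (simp add: min_value_eqI[OF xs(1)] field_simps)
qed

text \<open>
  All the points in the relation differ from \<open>x 0\<close> by combinations of earlier gradients, and
  the affine coefficients add up to one, so orthogonality of the gradients is enough.
\<close>

lemma gfom_run_orthogonality:
  fixes f :: "'a::euclidean_space \<Rightarrow> real"
  assumes run: "gfom_run N f x0 x" and i: "i \<in> {1..N}"
  shows "inner (gradient f (x i))
      (x i - ((1 - a) *\<^sub>R (x (i - 1) - c *\<^sub>R gradient f (x (i - 1)))
            + a *\<^sub>R (x 0 - d *\<^sub>R (\<Sum>j=0..i-1. b j *\<^sub>R gradient f (x j))))) = 0"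
proof -
  let ?g = "\<lambda>j. gradient f (x j)"
  have gg: "inner (?g i) (?g j) = 0" if "j < i" for j
    using run i that by (auto simp: gfom_run_def)
  have affine: "inner (?g i) (x k) = inner (?g i) (x 0)" if "k \<le> i" for k
  proof (cases "k = 0")
    case False
    with run i that have "x k \<in> (+) (x 0) ` span (?g ` {0..<k})"
      by (auto simp: gfom_run_def is_arg_min_def)
    then obtain v where v: "v \<in> span (?g ` {0..<k})" and xk: "x k = x 0 + v"
      by auto
    have "orthogonal (?g i) v"
      using gg that by (intro orthogonal_to_span[OF v]) (auto simp: orthogonal_def)
    then show ?thesis
      by (simp add: xk inner_right_distrib orthogonal_def)
  qed simp
  have "(\<Sum>j=0..i-1. b j * inner (?g i) (?g j)) = 0"
    using gg i by (intro sum.neutral) auto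
  then show ?thesis
    using affine[of i] affine[of "i - 1"] gg[of "i - 1"] i
    by (simp add: inner_simps inner_sum_right) (simp add: algebra_simps)
qed

section \<open>Smoothed support functions\<close>

text \<open>
  This is \<open>L\<close> times the maximum of \<open>inner x p - (norm p)\<^sup>2 / 2\<close> over \<open>p\<close> in \<open>C\<close>, in other words
  \<open>L / 2 * ((norm x)\<^sup>2 - (setdist {x} C)\<^sup>2)\<close>. For closed convex \<open>C\<close> it is also \<open>L\<close> times the Moreau
  envelope of the support function of \<open>C\<close>, which suits resisting examples: a maximum of linear
  functions shows a first-order method only the gradients of active ones, and the envelope is smooth.
\<close>

definition smoothed_support :: "real \<Rightarrow> 'a::euclidean_space set \<Rightarrow> 'a \<Rightarrow> real" where
  "smoothed_support L C x = L * (inner x (closest_point C x) - (norm (closest_point C x))\<^sup>2 / 2)"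

lemma smoothed_support_ge:
  assumes "closed C" and "p \<in> C" and "L \<ge> 0"
  shows "L * (inner x p - (norm p)\<^sup>2 / 2) \<le> smoothed_support L C x"
proof -
  have "(norm (x - closest_point C x))\<^sup>2 \<le> (norm (x - p))\<^sup>2"
    using closest_point_le[OF assms(1,2), of x] by (intro power_mono) (auto simp: dist_norm)
  then have "inner x p - (norm p)\<^sup>2 / 2
      \<le> inner x (closest_point C x) - (norm (closest_point C x))\<^sup>2 / 2"
    by (simp add: power2_norm_eq_inner inner_simps inner_commute)
  then show ?thesis
    using \<open>L \<ge> 0\<close> by (simp add: smoothed_support_def mult_left_mono)
qed

lemma smoothed_support_tangent:
  assumes "closed C" and "C \<noteq> {}" and "L \<ge> 0"
  shows "smoothed_support L C x + L * inner (y - x) (closest_point C x) \<le> smoothed_support L C y"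
proof -
  have "L * (inner y (closest_point C x) - (norm (closest_point C x))\<^sup>2 / 2) \<le> smoothed_support L C y"
    using assms by (intro smoothed_support_ge closest_point_in_set)
  then show ?thesis
    by (simp add: smoothed_support_def inner_diff_left algebra_simps)
qed

text \<open>
  The tangents at \<open>x\<close> and at \<open>x + h\<close> enclose the increment, and the projection is nonexpansive.
\<close>

lemma GDERIV_smoothed_support:
  assumes "convex C" and "closed C" and "C \<noteq> {}" and "L \<ge> 0"
  shows "GDERIV (smoothed_support L C) x :> L *\<^sub>R closest_point C x"
proof -
  let ?F = "smoothed_support L C" and ?P = "closest_point C"
  have quot: "norm (norm (?F (x + h) - ?F x - inner h (L *\<^sub>R ?P x)) / norm h) \<le> L * norm h" for h
  proof -
    have "0 \<le> ?F (x + h) - ?F x - inner h (L *\<^sub>R ?P x)"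
      using smoothed_support_tangent[OF assms(2-4), of x "x + h"] by simp
    moreover have "?F (x + h) - ?F x - inner h (L *\<^sub>R ?P x) \<le> L * inner h (?P (x + h) - ?P x)"
      using smoothed_support_tangent[OF assms(2-4), of "x + h" x]
      by (simp add: inner_diff_right algebra_simps)
    moreover have "inner h (?P (x + h) - ?P x) \<le> norm h * norm h"
    proof -
      have "inner h (?P (x + h) - ?P x) \<le> norm h * norm (?P (x + h) - ?P x)"
        by (rule norm_cauchy_schwarz)
      also have "\<dots> \<le> norm h * norm h"
        using closest_point_lipschitz[OF assms(1-3), of "x + h" x]
        by (intro mult_left_mono) (auto simp: dist_norm)
      finally show ?thesis .
    qed
    ultimately have "norm (?F (x + h) - ?F x - inner h (L *\<^sub>R ?P x)) \<le> L * (norm h * norm h)"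
      using \<open>L \<ge> 0\<close> mult_left_mono[of "inner h (?P (x + h) - ?P x)" "norm h * norm h" L] by simp
    then show ?thesis
      using \<open>L \<ge> 0\<close> by (cases "h = 0") (simp_all add: divide_le_eq mult.assoc)
  qed
  have "((\<lambda>h. L * norm h) \<longlongrightarrow> 0) (at (0 :: 'a))"
    by (auto intro!: tendsto_eq_intros)
  then have "((\<lambda>h. norm (?F (x + h) - ?F x - inner h (L *\<^sub>R ?P x)) / norm h) \<longlongrightarrow> 0) (at 0)"
    by (rule Lim_null_comparison[rotated]) (rule always_eventually, use quot in blast)
  then show ?thesis
    unfolding gderiv_def has_derivative_at using bounded_linear_inner_left by blast
qed

lemma gradient_smoothed_support:
  assumes "convex C" and "closed C" and "C \<noteq> {}" and "L \<ge> 0"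
  shows "gradient (smoothed_support L C) x = L *\<^sub>R closest_point C x"
  using GDERIV_smoothed_support[OF assms] by (rule gradient_eqI)

lemma convex_smooth_smoothed_support:
  assumes "convex C" and "closed C" and "C \<noteq> {}" and "L \<ge> 0"
  shows "convex_smooth L (smoothed_support L C)"
  unfolding convex_smooth_def
proof (intro conjI allI)
  let ?F = "smoothed_support L C" and ?P = "closest_point C"
  show "convex_on UNIV ?F"
  proof (rule convex_onI)
    fix t :: real and x y :: 'a
    assume t: "0 < t" "t < 1"
    define z where "z = (1 - t) *\<^sub>R x + t *\<^sub>R y"
    have "(1 - t) * (?F z + L * inner (x - z) (?P z)) + t * (?F z + L * inner (y - z) (?P z))
        \<le> (1 - t) * ?F x + t * ?F y"
      using t by (intro add_mono mult_left_mono smoothed_support_tangent assms(2-4)) auto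
    moreover have "(1 - t) * (?F z + L * inner (x - z) (?P z)) + t * (?F z + L * inner (y - z) (?P z))
        = ?F z + L * inner ((1 - t) *\<^sub>R (x - z) + t *\<^sub>R (y - z)) (?P z)"
      by (simp add: inner_add_left algebra_simps)
    moreover have "(1 - t) *\<^sub>R (x - z) + t *\<^sub>R (y - z) = 0"
      by (simp add: z_def algebra_simps)
    ultimately show "?F ((1 - t) *\<^sub>R x + t *\<^sub>R y) \<le> (1 - t) * ?F x + t * ?F y"
      by (simp add: z_def)
  qed simp
  show "?F differentiable (at x)" for x
    using GDERIV_smoothed_support[OF assms, of x] by (auto simp: gderiv_def differentiable_def)
  show "L-lipschitz_on UNIV (gradient ?F)"
  proof (rule lipschitz_onI)
    show "dist (gradient ?F x) (gradient ?F y) \<le> L * dist x y" for x y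
      using closest_point_lipschitz[OF assms(1-3), of x y] \<open>L \<ge> 0\<close>
      by (simp add: gradient_smoothed_support[OF assms] dist_norm mult_left_mono
          flip: scaleR_diff_right)
  qed fact
qed

section \<open>A worst-case function\<close>

text \<open>
  Here \<open>s i\<close> stands for \<open>tau i N\<close>. That the greedy method passes through the points \<open>x i\<close> depends only on
  the bound and the decay below. The recurrence of \<open>theta\<close> enters when the value at \<open>x N\<close> is compared
  with the initial distance to the minimizer.
\<close>

locale worst_case =
  fixes N :: nat and h :: "nat \<Rightarrow> 'a::euclidean_space" and s :: "nat \<Rightarrow> real" and L :: real
  assumes L_pos: "L > 0"
    and s_ge_1: "1 \<le> s i"
    and orth: "i \<le> N \<Longrightarrow> j \<le> N \<Longrightarrow> i \<noteq> j \<Longrightarrow> inner (h i) (h j) = 0"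
    and decay: "i < N \<Longrightarrow> s (Suc i) * (norm (h (Suc i)))\<^sup>2 = (s i - 1) * (norm (h i))\<^sup>2"
begin

definition C :: "'a set" where
  "C = convex hull insert 0 (h ` {..N})"

definition x :: "nat \<Rightarrow> 'a" where
  "x i = (\<Sum>j=i..N. s j *\<^sub>R h j)"

abbreviation F :: "'a \<Rightarrow> real" where
  "F \<equiv> smoothed_support L C"

lemma C: "convex C" "closed C" "C \<noteq> {}" "L \<ge> 0" "0 \<in> C"
  using L_pos by (auto simp: C_def hull_inc compact_convex_hull compact_imp_closed finite_imp_compact)

lemma inner_x: "k \<le> N \<Longrightarrow> inner (x i) (h k) = (if i \<le> k then s k * (norm (h k))\<^sup>2 else 0)"
proof -
  assume "k \<le> N"
  then have "inner (x i) (h k) = (\<Sum>j=i..N. if j = k then s k * (norm (h k))\<^sup>2 else 0)"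
    unfolding x_def inner_sum_left
    by (intro sum.cong) (auto simp: orth power2_norm_eq_inner)
  with \<open>k \<le> N\<close> show ?thesis
    by simp
qed

lemma later_weight_le:
  assumes "i < j" and "j \<le> N"
  shows "s j * (norm (h j))\<^sup>2 \<le> (s i - 1) * (norm (h i))\<^sup>2"
  using assms
proof (induction j)
  case (Suc j)
  show ?case
  proof (cases "i = j")
    case True
    with Suc.prems show ?thesis
      using decay[of j] by simp
  next
    case False
    have "s (Suc j) * (norm (h (Suc j)))\<^sup>2 \<le> s j * (norm (h j))\<^sup>2"
      using decay[of j] Suc.prems by (simp add: left_diff_distrib)
    with Suc False show ?thesis
      by simp
  qed
qed simp

text \<open>
  The condition \<open>inner (x i - h i) (p - h i) \<le> 0\<close> is affine in \<open>p\<close>, so it suffices to check it at the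
  generators of \<open>C\<close>. At later \<open>h j\<close> it is the decay of the norms, elsewhere it is \<open>s i \<ge> 1\<close>.
\<close>

lemma closest_point_x:
  assumes "i \<le> N"
  shows "closest_point C (x i) = h i"
proof -
  define v where "v = x i - h i"
  have v_h: "inner v (h i) = (s i - 1) * (norm (h i))\<^sup>2"
    using assms by (simp add: v_def inner_diff_left inner_x power2_norm_eq_inner left_diff_distrib)
  then have v_h_nonneg: "0 \<le> inner v (h i)"
    using s_ge_1[of i] by simp
  have "inner v (h j) \<le> inner v (h i)" if "j \<le> N" for j
  proof (cases i j rule: linorder_cases)
    case less
    with that assms show ?thesis
      using later_weight_le[of i j] v_h by (simp add: v_def inner_diff_left inner_x orth)
  next
    case greater
    with that assms show ?thesis
      using v_h_nonneg by (simp add: v_def inner_diff_left inner_x orth)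
  qed simp
  then have "insert 0 (h ` {..N}) \<subseteq> {p. inner v p \<le> inner v (h i)}"
    using v_h_nonneg by auto
  then have "C \<subseteq> {p. inner v p \<le> inner v (h i)}"
    unfolding C_def by (intro hull_minimal convex_halfspace_le)
  then have obtuse: "inner v p \<le> inner v (h i)" if "p \<in> C" for p
    using that by blast
  have "dist (x i) (h i) \<le> dist (x i) p" if "p \<in> C" for p
  proof -
    have expand: "(norm (x i - p))\<^sup>2
        = (norm v)\<^sup>2 + (2 * (inner v (h i) - inner v p) + (norm (h i - p))\<^sup>2)"
      unfolding power2_norm_eq_inner v_def by (simp add: inner_simps inner_commute)
    have "0 \<le> 2 * (inner v (h i) - inner v p) + (norm (h i - p))\<^sup>2"
      using obtuse[OF that] by (intro add_nonneg_nonneg) auto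
    then have "(norm v)\<^sup>2 \<le> (norm (x i - p))\<^sup>2"
      unfolding expand by (simp only: le_add_same_cancel1)
    then show ?thesis
      by (simp add: dist_norm v_def)
  qed
  moreover have "h i \<in> C"
    using assms by (auto simp: C_def intro: hull_inc)
  ultimately show ?thesis
    using closest_point_unique[OF C(1,2), of "h i" "x i"] by simp
qed

lemma gradient_x: "i \<le> N \<Longrightarrow> gradient F (x i) = L *\<^sub>R h i"
  by (simp add: gradient_smoothed_support C closest_point_x)

lemma F_0: "F 0 = 0"
  using closest_point_self[OF C(5)] by (simp add: smoothed_support_def)

lemma is_arg_min_0: "is_arg_min F (\<lambda>_. True) 0"
  using smoothed_support_ge[OF C(2,5,4)] by (simp add: is_arg_min_linorder F_0)

lemma is_input_x: "norm (x 0) \<le> R \<Longrightarrow> is_input L R F (x 0)"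
  using convex_smooth_smoothed_support[OF C(1-4)] is_arg_min_0 by (auto simp: is_input_def)

text \<open>
  The step from \<open>x 0\<close> to \<open>x i\<close> is a combination of the earlier gradients, to which the gradient
  at \<open>x i\<close> is orthogonal. For a convex function this characterizes minimizers over a subspace.
\<close>

lemma gfom_run_x: "gfom_run N F (x 0) x"
  unfolding gfom_run_def
proof (intro conjI ballI allI impI)
  fix i assume i: "i \<in> {1..N}"
  let ?G = "(\<lambda>j. gradient F (x j)) ` {0..<i}"
  show orth_grad: "inner (gradient F (x i)) (gradient F (x j)) = 0" if "j < i" for j
    using that i by (simp add: gradient_x orth)
  have h_span: "h j \<in> span ?G" if "j < i" for j
  proof -
    have "(1 / L) *\<^sub>R gradient F (x j) \<in> span ?G"
      using that by (intro span_scale span_base) auto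
    then show ?thesis
      using that i L_pos by (simp add: gradient_x)
  qed
  have "x 0 = (\<Sum>j=0..<i. s j *\<^sub>R h j) + x i"
    unfolding x_def using i by (subst sum.union_disjoint[symmetric]) (auto intro!: sum.cong)
  then have x_i: "x i = x 0 + (- (\<Sum>j=0..<i. s j *\<^sub>R h j))"
    by simp
  have in_span: "- (\<Sum>j=0..<i. s j *\<^sub>R h j) \<in> span ?G"
    by (intro span_neg span_sum span_scale h_span) simp
  have "F (x i) \<le> F y" if "y \<in> (+) (x 0) ` span ?G" for y
  proof -
    from that obtain v where v: "v \<in> span ?G" and y: "y = x 0 + v"
      by auto
    have "y - x i = v - (- (\<Sum>j=0..<i. s j *\<^sub>R h j))"
      using x_i y by simp
    then have "y - x i \<in> span ?G"
      using span_diff[OF v in_span] by simp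
    then have "orthogonal (gradient F (x i)) (y - x i)"
      by (rule orthogonal_to_span) (auto simp: orthogonal_def orth_grad)
    then have "inner (y - x i) (closest_point C (x i)) = 0"
      using i L_pos by (simp add: gradient_x closest_point_x orthogonal_def inner_commute)
    then show ?thesis
      using smoothed_support_tangent[OF C(2-4), of "x i" y] by simp
  qed
  then show "is_arg_min F (\<lambda>y. y \<in> (+) (x 0) ` span ?G) (x i)"
    unfolding is_arg_min_linorder using x_i in_span by blast
qed simp

lemma F_x_N: "F (x N) = L * (s N - 1 / 2) * (norm (h N))\<^sup>2"
  using inner_x[of N N] by (simp add: smoothed_support_def closest_point_x algebra_simps)

lemma norm_x_0: "(norm (x 0))\<^sup>2 = (\<Sum>j\<le>N. (s j)\<^sup>2 * (norm (h j))\<^sup>2)"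
proof -
  have "(norm (x 0))\<^sup>2 = (\<Sum>j=0..N. s j * inner (x 0) (h j))"
    unfolding power2_norm_eq_inner by (subst (2) x_def) (simp add: inner_sum_right)
  then show ?thesis
    by (simp add: inner_x power2_eq_square atLeast0AtMost mult.assoc)
qed

end

section \<open>Tightness\<close>

text \<open>The squared norms demanded by the worst-case function, up to a common factor.\<close>

primrec squared_norm_ratio :: "nat \<Rightarrow> nat \<Rightarrow> real" where
  "squared_norm_ratio N 0 = 1"
| "squared_norm_ratio N (Suc i) = (tau i N - 1) / tau (Suc i) N * squared_norm_ratio N i"

lemma squared_norm_ratio_pos: "0 < N \<Longrightarrow> i \<le> N \<Longrightarrow> 0 < squared_norm_ratio N i"
proof (induction i)
  case (Suc i)
  then have "1 < tau i N"
    using theta_ge_1[of i N] by (simp add: tau_def last_factor_def)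
  with Suc tau_ge_1[of "Suc i" N] show ?case
    by simp
qed simp

text \<open>
  For \<open>i = N\<close> the sum is, up to the common factor, the squared distance from \<open>x 0\<close> to the minimizer.
  It is a multiple of its last term because of \<open>theta_recurrence\<close>.
\<close>

lemma sum_squared_norm_ratio:
  "i \<le> N \<Longrightarrow> (\<Sum>j\<le>i. (tau j N)\<^sup>2 * squared_norm_ratio N j)
    = (tau i N)\<^sup>2 * (2 * theta i N - 1) * squared_norm_ratio N i"
proof (induction i)
  case (Suc i)
  define a where "a = squared_norm_ratio N (Suc i)"
  define t where "t = theta (Suc i) N"
  define w where "w = last_factor (Suc i) N"
  have "(tau i N - 1) * squared_norm_ratio N i = tau (Suc i) N * a"
    using tau_ge_1[of "Suc i" N] by (simp add: a_def)
  moreover have "2 * theta i N = tau i N"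
    using Suc.prems by (simp add: tau_def last_factor_def)
  ultimately have "(\<Sum>j\<le>Suc i. (tau j N)\<^sup>2 * squared_norm_ratio N j)
      = (tau i N)\<^sup>2 * (tau (Suc i) N * a) + (tau (Suc i) N)\<^sup>2 * a"
    using Suc by (simp add: a_def mult.assoc)
  also have "(tau i N)\<^sup>2 = 2 * (w * (t\<^sup>2 - t))"
    using theta_recurrence[of i N] Suc.prems
    by (simp add: w_def t_def tau_def last_factor_def power_mult_distrib)
  also have "2 * (w * (t\<^sup>2 - t)) * (tau (Suc i) N * a) + (tau (Suc i) N)\<^sup>2 * a
      = (tau (Suc i) N)\<^sup>2 * (2 * t - 1) * a"
    unfolding tau_def w_def[symmetric] t_def[symmetric]
    by (simp add: power2_eq_square algebra_simps)
  finally show ?case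
    by (simp add: a_def t_def)
qed (simp add: tau_def)

theorem bound_attained:
  fixes L R :: real
  assumes "L > 0" and "R \<ge> 0" and "N \<ge> 1" and dim: "N < DIM('a::euclidean_space)"
  obtains F :: "'a::euclidean_space \<Rightarrow> real" and z0 y where "is_input L R F z0" and "gfom_output N F z0 y"
    and "F y - min_value F = L * R\<^sup>2 / (2 * (theta N N)\<^sup>2)"
proof -
  let ?a = "squared_norm_ratio N"
  obtain e :: "nat \<Rightarrow> 'a" where e: "e ` {..N} \<subseteq> Basis" "inj_on e {..N}"
    using card_le_inj[of "{..N}" "Basis :: 'a set"] dim by auto
  have inner_e: "inner (e i) (e j) = (if i = j then 1 else 0)" if "i \<le> N" "j \<le> N" for i j
    using that e by (subst inner_Basis) (auto dest: inj_onD)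
  define S where "S = (\<Sum>j\<le>N. (tau j N)\<^sup>2 * ?a j)"
  have S: "S = (theta N N)\<^sup>2 * (2 * theta N N - 1) * ?a N"
    unfolding S_def sum_squared_norm_ratio[OF order.refl] by (simp add: tau_def last_factor_def)
  have a_pos: "0 < ?a i" if "i \<le> N" for i
    using squared_norm_ratio_pos[of N i] that \<open>N \<ge> 1\<close> by simp
  have "0 < S"
    unfolding S using a_pos[of N] theta_ge_1[of N N] by simp
  define h where "h = (\<lambda>i. (R * sqrt (?a i / S)) *\<^sub>R e i)"
  have norm_h: "(norm (h i))\<^sup>2 = R\<^sup>2 / S * ?a i" if "i \<le> N" for i
  proof -
    have "norm (e i) = 1"
      using that e(1) by auto
    then show ?thesis
      using a_pos[OF that] \<open>0 < S\<close> by (simp add: h_def power_mult_distrib)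
  qed
  interpret worst_case N h "\<lambda>i. tau i N" L
  proof
    show "tau (Suc i) N * (norm (h (Suc i)))\<^sup>2 = (tau i N - 1) * (norm (h i))\<^sup>2" if "i < N" for i
      using that tau_ge_1[of "Suc i" N] by (simp add: norm_h)
  qed (use \<open>L > 0\<close> tau_ge_1 in \<open>simp_all add: h_def inner_e\<close>)
  have "(norm (x 0))\<^sup>2 = R\<^sup>2 / S * (\<Sum>j\<le>N. (tau j N)\<^sup>2 * squared_norm_ratio N j)"
    unfolding norm_x_0 sum_distrib_left by (intro sum.cong) (simp_all add: norm_h)
  then have "norm (x 0) = R"
    using \<open>0 < S\<close> \<open>R \<ge> 0\<close> by (simp flip: S_def)
  then have "is_input L R F (x 0)"
    by (simp add: is_input_x)
  moreover have "gfom_output N F (x 0) (x N)"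
    using gfom_run_x by (auto simp: gfom_output_def)
  moreover have "F (x N) - min_value F = L * R\<^sup>2 / (2 * (theta N N)\<^sup>2)"
  proof -
    define t where "t = theta N N"
    have "2 * t - 1 \<noteq> 0" "t \<noteq> 0" "squared_norm_ratio N N \<noteq> 0"
      using a_pos[of N] theta_ge_1[of N N] by (auto simp: t_def)
    moreover have "tau N N - 1 / 2 = (2 * t - 1) / 2"
      by (simp add: t_def tau_def last_factor_def diff_divide_distrib)
    then have "F (x N) = L * ((2 * t - 1) / 2) * (R\<^sup>2 / (t\<^sup>2 * (2 * t - 1) * squared_norm_ratio N N)
        * squared_norm_ratio N N)"
      by (simp only: F_x_N norm_h[OF order.refl] S t_def)
    ultimately have "F (x N) = L * R\<^sup>2 / (2 * t\<^sup>2)"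
      by simp
    then show ?thesis
      by (simp add: min_value_eqI[OF is_arg_min_0] F_0 t_def)
  qed
  ultimately show ?thesis
    by (rule that)
qed

theorem corollary5:
  fixes f :: "real ^ 'd \<Rightarrow> real" and x0 :: "real ^ 'd" and L R :: real
  assumes "L > 0" and "R \<ge> 0" and "is_input L R f x0"
  shows
    "(\<forall>N\<ge>1.
        (\<forall>y. gfom_output N f x0 y \<longrightarrow>
           f y - min_value f \<le> L * R\<^sup>2 / (2 * (theta N N)\<^sup>2)) \<and>
        (CARD('d) \<ge> 2 * N + 2 \<longrightarrow>
           (\<forall>\<epsilon>>0. \<exists>(g :: real ^ 'd \<Rightarrow> real) z0 y.
              is_input L R g z0 \<and> gfom_output N g z0 y \<and>
              g y - min_value g \<ge> L * R\<^sup>2 / (2 * (theta N N)\<^sup>2) - \<epsilon>))) \<and>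
     (\<forall>N\<ge>1. \<forall>x :: nat \<Rightarrow> real ^ 'd.
        x 0 = x0 \<and>
        (\<forall>i\<in>{1..N}.
           inner (gradient f (x i))
             (x i - ((1 - 1 / theta i N) *\<^sub>R (x (i - 1) - (1 / L) *\<^sub>R gradient f (x (i - 1)))
                   + (1 / theta i N) *\<^sub>R
                       (x0 - (2 / L) *\<^sub>R (\<Sum>j=0..i-1. theta j N *\<^sub>R gradient f (x j))))) = 0)
        \<longrightarrow> f (x N) - min_value f \<le> L * R\<^sup>2 / (2 * (theta N N)\<^sup>2))"
proof (intro conjI allI impI)
  fix N :: nat and y
  assume "gfom_output N f x0 y"
  then obtain x where run: "gfom_run N f x0 x" and y: "y = x N"
    by (auto simp: gfom_output_def)
  then have "x0 = x 0"
    by (simp add: gfom_run_def)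
  with assms(3) have "is_input L R f (x 0)"
    by simp
  then show "f y - min_value f \<le> L * R\<^sup>2 / (2 * (theta N N)\<^sup>2)"
    unfolding y by (rule convergence_rate[OF \<open>L > 0\<close> _ gfom_run_orthogonality[OF run]])
next
  fix N :: nat and \<epsilon> :: real
  assume "1 \<le> N" "2 * N + 2 \<le> CARD('d)" "0 < \<epsilon>"
  then have "N < DIM(real ^ 'd)"
    by simp
  from bound_attained[OF \<open>L > 0\<close> \<open>R \<ge> 0\<close> \<open>1 \<le> N\<close> this]
  obtain g :: "real ^ 'd \<Rightarrow> real" and z0 y where "is_input L R g z0" "gfom_output N g z0 y"
    "g y - min_value g = L * R\<^sup>2 / (2 * (theta N N)\<^sup>2)" .
  with \<open>0 < \<epsilon>\<close> show "\<exists>(g :: real ^ 'd \<Rightarrow> real) z0 y.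
      is_input L R g z0 \<and> gfom_output N g z0 y \<and>
      g y - min_value g \<ge> L * R\<^sup>2 / (2 * (theta N N)\<^sup>2) - \<epsilon>"
    by (intro exI[of _ g] exI[of _ z0] exI[of _ y]) simp
next
  fix N :: nat and x :: "nat \<Rightarrow> real ^ 'd"
  assume x: "x 0 = x0 \<and>
        (\<forall>i\<in>{1..N}.
           inner (gradient f (x i))
             (x i - ((1 - 1 / theta i N) *\<^sub>R (x (i - 1) - (1 / L) *\<^sub>R gradient f (x (i - 1)))
                   + (1 / theta i N) *\<^sub>R
                       (x0 - (2 / L) *\<^sub>R (\<Sum>j=0..i-1. theta j N *\<^sub>R gradient f (x j))))) = 0)"
  with assms(3) have "is_input L R f (x 0)"
    by simp
  then show "f (x N) - min_value f \<le> L * R\<^sup>2 / (2 * (theta N N)\<^sup>2)"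
    by (rule convergence_rate[OF \<open>L > 0\<close>]) (use x in simp)
qed

end
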